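(* Let $\varepsilon,\delta\in[0,1]$. Let $G=(X\times Y,A\times B,\mu,V)$ be a biregular two-player game, and let $M$ (on vertex sets $(X',X)$) and $P$ (on vertex sets $(Y',Y)$) be two bipartite $\lambda$-spectral expanders. If $\lambda\le \frac{\varepsilon}{2}\sqrt{\frac{\delta}{2}}$, then the concatenated game $G'=(M\circ G\circ P)$ is $(\varepsilon,\delta)$-weakly fortified against classical substrategies; that is, for every classical substrategy $(f,g)$ for $G'$, $$\mathrm{Val}(G',f,g)\le(\mathrm{Val}(G)+\varepsilon)\cdot\mathop{\mathbb E}_{(x,y)\sim\mu} f(x)\,g(y)+\delta .$$
   Context: Games. A two-player game $G=(X\times Y,A\times B,\mu,V)$ consists of finite question sets $X,Y$, finite answer sets $A,B$, a probability distribution $\mu$ on $X\times Y$, and a predicate $V:A\times B\times X\times Y\to\{0,1\}$. $G$ is biregular if both marginals of $\mu$ (on $X$ and on $Y$) are uniform. Classical substrategies. A classical substrategy for $G$ is a pair $f:X\times A\to[0,1]$, $g:Y\times B\to[0,1]$ with $f(x):=\sum_a f(x,a)\le1$ for all $x$ and $g(y):=\sum_b g(y,b)\le 1$ for all $y$. It is a complete strategy if all these are equalities. Its value is $\mathrm{Val}(G,f,g)=\mathbb E_{(x,y)\sim\mu}\sum_{a,b}V(a,b,x,y)f(x,a)g(y,b)$, and $\mathrm{Val}(G)$ is the supremum of $\mathrm{Val}(G,f,g)$ over complete strategies. Concatenated games. Let $M,P$ be bipartite graphs on vertex sets $(X',X)$ and $(Y',Y)$; $N(\cdot)$ denotes the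 set of neighbours of a vertex. In $G'=(M\circ G\circ P)$ the referee samples $(x,y)\sim\mu$ and independent uniformly random neighbours $x'\sim N(x)$ (in $M$) and $y'\sim N(y)$ (in $P$). The players receive $x'$ and $y'$ and answer with maps $a':N(x')\to A$ and $b':N(y')\to B$; they win iff $V(a'(x),b'(y),x,y)=1$. A classical substrategy for $G'$ is a pair of nonnegative functions $f(x',a')$, $g(y',b')$ ($a'$ ranging over maps $N(x')\to A$, $b'$ over maps $N(y')\to B$) with $\sum_{a'}f(x',a')\le1$, $\sum_{b'}g(y',b')\le1$, and $$\mathrm{Val}(G',f,g)=\mathbb E_{(x,y)\sim\mu}\mathbb E_{x'\sim N(x)}\mathbb E_{y'\sim N(y)}\sum_{a',b'}V(a'(x),b'(y),x,y)f(x',a')g(y',b').$$ The induced substrategy on $G$ (denoted by the same letters) is $f(x,a)=\mathbb E_{x'\sim N(x)}\sum_{a':a'(x)=a}f(x',a')$ and $g(y,b)=\mathbb E_{y'\sim N(y)}\sum_{b':b'(y)=b}g(y',b')$; $f(x)=\sum_a f(x,a)$ and $g(y)=\sum_b g(y,b)$ are the induced totals. Expanders. Bipartite graphs $M=(X'\times X,E)$ here are $X$-regular: $|N(x)|=d\geq 1$ for all $x\in X$. Let $\mu_X(x)=1/|X|$ and $\mu'(x')=\frac{|N(x')|}{d|X|}$ (the distribution of a random neighbour of a uniform $x\in X$). The normalized adjacency matrix $\mathcal M$ has entries $\mathcal M(x,x')=\frac1d\sqrt{\mu_X(x)/\mu'(x')}$ if $x'\in N(x)$ and $0$ otherwise.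 $M$ is a $\lambda$-spectral expander if the second-largest singular value of $\mathcal M$ is at most $\lambda$. For $P$ the definition is the same with $Y',Y$ in place of $X',X$. *)

theory Defs
  imports "HOL-Probability.Probability"
begin

section \<open>Two-player games and classical substrategies\<close>

text \<open>Question and answer sets are (nonempty) finite types.\<close>

record ('x, 'y, 'a, 'b) game =
  questions :: "('x \<times> 'y) pmf"
  wins :: "'a \<Rightarrow> 'b \<Rightarrow> 'x \<Rightarrow> 'y \<Rightarrow> bool"

definition biregular :: "('x::finite, 'y::finite, 'a, 'b) game \<Rightarrow> bool" where
  "biregular G \<longleftrightarrow>
     map_pmf fst (questions G) = pmf_of_set UNIV \<and>
     map_pmf snd (questions G) = pmf_of_set UNIV"

definition total :: "('q \<Rightarrow> 'a::finite \<Rightarrow> real) \<Rightarrow> 'q \<Rightarrow> real" where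
  "total f q = (\<Sum>a\<in>UNIV. f q a)"

definition substrategy :: "('q \<Rightarrow> 'a::finite \<Rightarrow> real) \<Rightarrow> bool" where
  "substrategy f \<longleftrightarrow> (\<forall>q a. f q a \<in> {0..1}) \<and> (\<forall>q. total f q \<le> 1)"

definition complete_strategy :: "('q \<Rightarrow> 'a::finite \<Rightarrow> real) \<Rightarrow> bool" where
  "complete_strategy f \<longleftrightarrow> substrategy f \<and> (\<forall>q. total f q = 1)"

definition strategy_value ::
  "('x, 'y, 'a::finite, 'b::finite) game \<Rightarrow> ('x \<Rightarrow> 'a \<Rightarrow> real) \<Rightarrow> ('y \<Rightarrow> 'b \<Rightarrow> real) \<Rightarrow> real" where
  "strategy_value G f g =
     measure_pmf.expectation (questions G) (\<lambda>(x, y).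
       \<Sum>a\<in>UNIV. \<Sum>b\<in>UNIV. of_bool (wins G a b x y) * f x a * g y b)"

definition game_value :: "('x, 'y, 'a::finite, 'b::finite) game \<Rightarrow> real" where
  "game_value G =
     (SUP (f, g) \<in> {(f, g). complete_strategy f \<and> complete_strategy g}. strategy_value G f g)"

section \<open>Bipartite graphs and spectral expanders\<close>

text \<open>A bipartite graph on \<open>(X', X)\<close> is its edge set, a subset of \<open>X' \<times> X\<close>; the two sides
  are the types \<open>'u\<close> (for \<open>X'\<close>) and \<open>'v\<close> (for \<open>X\<close>).\<close>

type_synonym ('u, 'v) bigraph = "('u \<times> 'v) set"

definition nbrs_outer :: "('u, 'v) bigraph \<Rightarrow> 'u \<Rightarrow> 'v set" where
  "nbrs_outer E u = {v. (u, v) \<in> E}"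

definition nbrs_inner :: "('u, 'v) bigraph \<Rightarrow> 'v \<Rightarrow> 'u set" where
  "nbrs_inner E v = {u. (u, v) \<in> E}"

definition inner_regular :: "nat \<Rightarrow> ('u::finite, 'v) bigraph \<Rightarrow> bool" where
  "inner_regular d E \<longleftrightarrow> d \<ge> 1 \<and> (\<forall>v. card (nbrs_inner E v) = d)"

definition inner_weight :: "'v::finite \<Rightarrow> real" where
  "inner_weight v = 1 / real CARD('v)"

definition outer_weight :: "nat \<Rightarrow> ('u, 'v::finite) bigraph \<Rightarrow> 'u \<Rightarrow> real" where
  "outer_weight d E u = real (card (nbrs_outer E u)) / (real d * real CARD('v))"

definition normalized_adjacency :: "nat \<Rightarrow> ('u::finite, 'v::finite) bigraph \<Rightarrow> real^'u^'v" where
  "normalized_adjacency d E =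
     (\<chi> v u. if u \<in> nbrs_inner E v
             then 1 / real d * sqrt (inner_weight v / outer_weight d E u) else 0)"

text \<open>The singular values of \<open>A\<close> are the square roots of the eigenvalues of \<open>A A\<^sup>T\<close>, each
  repeated according to the dimension of its eigenspace.\<close>

definition gram_eigenspace :: "real^'u^'v \<Rightarrow> real \<Rightarrow> (real^'v) set" where
  "gram_eigenspace A \<sigma> = {w. (A ** transpose A) *v w = \<sigma>\<^sup>2 *\<^sub>R w}"

definition singular_value :: "real^'u^'v \<Rightarrow> real \<Rightarrow> bool" where
  "singular_value A \<sigma> \<longleftrightarrow> \<sigma> \<ge> 0 \<and> (\<exists>w. w \<noteq> 0 \<and> w \<in> gram_eigenspace A \<sigma>)"

definition singular_values :: "real^'u^'v \<Rightarrow> real multiset" where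
  "singular_values A =
     (\<Sum>\<sigma>\<in>{\<sigma>. singular_value A \<sigma>}. replicate_mset (dim (gram_eigenspace A \<sigma>)) \<sigma>)"

text \<open>The multiset sum above is meaningful only because its index set is finite.\<close>

lemma finite_singular_values:
  fixes A :: "real^'u^'v"
  shows "finite {\<sigma>. singular_value A \<sigma>}"
proof -
  let ?S = "{\<sigma>. singular_value A \<sigma>}"
  let ?B = "A ** transpose A"
  define e where "e \<sigma> = (SOME w. w \<noteq> 0 \<and> w \<in> gram_eigenspace A \<sigma>)" for \<sigma>
  have e: "e \<sigma> \<noteq> 0" "?B *v e \<sigma> = \<sigma>\<^sup>2 *\<^sub>R e \<sigma>" if "\<sigma> \<in> ?S" for \<sigma>
  proof -
    from that have "\<exists>w. w \<noteq> 0 \<and> w \<in> gram_eigenspace A \<sigma>"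
      by (simp add: singular_value_def)
    from someI_ex[OF this] show "e \<sigma> \<noteq> 0" "?B *v e \<sigma> = \<sigma>\<^sup>2 *\<^sub>R e \<sigma>"
      by (simp_all add: e_def gram_eigenspace_def)
  qed
  have sym: "transpose ?B = ?B"
    by (simp add: matrix_transpose_mul)
  have orth: "orthogonal (e \<sigma>) (e \<tau>)" if "\<sigma> \<in> ?S" "\<tau> \<in> ?S" "\<sigma> \<noteq> \<tau>" for \<sigma> \<tau>
  proof -
    have "(?B *v e \<sigma>) \<bullet> e \<tau> = e \<sigma> \<bullet> (?B *v e \<tau>)"
      by (metis dot_lmul_matrix sym transpose_matrix_vector)
    then have "(\<sigma>\<^sup>2 - \<tau>\<^sup>2) * (e \<sigma> \<bullet> e \<tau>) = 0"
      using e that by (simp add: algebra_simps)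
    moreover have "\<sigma>\<^sup>2 \<noteq> \<tau>\<^sup>2"
      using that by (simp add: singular_value_def power2_eq_iff_nonneg)
    ultimately show ?thesis
      by (simp add: orthogonal_def)
  qed
  have inj: "inj_on e ?S"
    by (rule inj_onI) (metis e(1) orth orthogonal_self)
  have "pairwise orthogonal (e ` ?S)"
    using orth by (auto simp: pairwise_def)
  moreover have "0 \<notin> e ` ?S"
    using e(1) by force
  ultimately have "independent (e ` ?S)"
    by (rule pairwise_orthogonal_independent)
  then have "finite (e ` ?S)"
    by (rule independent_imp_finite)
  then show ?thesis
    using inj by (rule finite_imageD)
qed

text \<open>Using \<open>A A\<^sup>T\<close> rather than \<open>A\<^sup>T A\<close> only changes the number of zeros in the multiset. A matrix
  with one row or one column has no second singular value; it is taken to be \<open>0\<close>.\<close>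

definition second_singular_value :: "real^'u^'v \<Rightarrow> real" where
  "second_singular_value A =
     (let s = rev (sorted_list_of_multiset (singular_values A))
      in if length s \<ge> 2 then s ! 1 else 0)"

definition spectral_expander :: "nat \<Rightarrow> real \<Rightarrow> ('u::finite, 'v::finite) bigraph \<Rightarrow> bool" where
  "spectral_expander d l E \<longleftrightarrow>
     inner_regular d E \<and> second_singular_value (normalized_adjacency d E) \<le> l"

section \<open>Concatenated games\<close>

text \<open>Maps \<open>N(u) \<rightarrow> A\<close> are functions on the whole type that are \<open>undefined\<close> outside \<open>N(u)\<close>, so
  that every such map is counted exactly once in the sums below.\<close>

definition answer_maps :: "('u, 'v) bigraph \<Rightarrow> 'u \<Rightarrow> ('v \<Rightarrow> 'a) set" where
  "answer_maps E u = nbrs_outer E u \<rightarrow>\<^sub>E UNIV"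

definition concat_substrategy ::
  "('u, 'v::finite) bigraph \<Rightarrow> ('u \<Rightarrow> ('v \<Rightarrow> 'a::finite) \<Rightarrow> real) \<Rightarrow> bool" where
  "concat_substrategy E f \<longleftrightarrow>
     (\<forall>u. (\<forall>a'\<in>answer_maps E u. f u a' \<ge> 0) \<and> (\<Sum>a'\<in>answer_maps E u. f u a') \<le> 1)"

definition concat_value ::
  "('u, 'x::finite) bigraph \<Rightarrow> ('x, 'y::finite, 'a::finite, 'b::finite) game \<Rightarrow> ('w, 'y) bigraph \<Rightarrow>
   ('u \<Rightarrow> ('x \<Rightarrow> 'a) \<Rightarrow> real) \<Rightarrow> ('w \<Rightarrow> ('y \<Rightarrow> 'b) \<Rightarrow> real) \<Rightarrow> real" where
  "concat_value M G P f g =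
     measure_pmf.expectation (questions G) (\<lambda>(x, y).
       measure_pmf.expectation (pmf_of_set (nbrs_inner M x)) (\<lambda>x'.
         measure_pmf.expectation (pmf_of_set (nbrs_inner P y)) (\<lambda>y'.
           \<Sum>a'\<in>answer_maps M x'. \<Sum>b'\<in>answer_maps P y'.
             of_bool (wins G (a' x) (b' y) x y) * f x' a' * g y' b')))"

definition induced ::
  "('u, 'v::finite) bigraph \<Rightarrow> ('u \<Rightarrow> ('v \<Rightarrow> 'a::finite) \<Rightarrow> real) \<Rightarrow> 'v \<Rightarrow> 'a \<Rightarrow> real" where
  "induced E f v a =
     measure_pmf.expectation (pmf_of_set (nbrs_inner E v)) (\<lambda>u.
       \<Sum>a' | a' \<in> answer_maps E u \<and> a' v = a. f u a')"

definition weakly_fortified ::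
  "real \<Rightarrow> real \<Rightarrow> ('u, 'x::finite) bigraph \<Rightarrow> ('x, 'y::finite, 'a::finite, 'b::finite) game \<Rightarrow>
   ('w, 'y) bigraph \<Rightarrow> bool" where
  "weakly_fortified \<epsilon> \<delta> M G P \<longleftrightarrow>
     (\<forall>f g. concat_substrategy M f \<and> concat_substrategy P g \<longrightarrow>
        concat_value M G P f g \<le>
          (game_value G + \<epsilon>) *
            measure_pmf.expectation (questions G)
              (\<lambda>(x, y). total (induced M f) x * total (induced P g) y) + \<delta>)"

end

theory Submission
  imports Defs
begin

text \<open>
  The winning probability is bilinear in the answers, so the concatenated value of \<open>(f, g)\<close> is the
  value on \<open>G\<close> of the induced substrategy. Let \<open>r\<close>, \<open>s\<close> be the induced totals, with means \<open>\<alpha>\<close>, \<open>\<beta>\<close>.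
  Normalising gives complete strategies of value at most \<open>Val(G)\<close>, and the concatenated value is
  the expectation of \<open>r s W\<close>, where \<open>W \<in> [0, 1]\<close> is the winning probability of these. As \<open>r\<close> and \<open>s\<close>
  are neighbour averages of \<open>[0, 1]\<close>-valued functions, the spectral gap bounds their variances by
  \<open>\<lambda>\<^sup>2 \<alpha>\<close> and \<open>\<lambda>\<^sup>2 \<beta>\<close>. Replacing \<open>r s\<close> by \<open>\<alpha> \<beta>\<close> thus costs \<open>O(\<lambda> sqrt (\<alpha> \<beta>) + \<lambda>\<^sup>2)\<close>,
  which AM-GM turns into at most \<open>\<epsilon> \<alpha> \<beta> + \<delta>\<close>.
\<close>

section \<open>Singular values\<close>

text \<open>In a decreasing list only the head can strictly exceed the entry at index 1. If both
  \<open>a\<close> and \<open>b\<close> exceeded it, two entries, counted with multiplicity, would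
  have to lie strictly above it.\<close>

lemma min_le_second_of_sorted_list:
  fixes S :: "real multiset"
  assumes "{#a, b#} \<subseteq># S"
  defines "xs \<equiv> rev (sorted_list_of_multiset S)"
  shows "2 \<le> length xs" and "min a b \<le> xs ! 1"
proof -
  have S: "mset xs = S" by (simp add: xs_def)
  have "2 \<le> size S"
    using size_mset_mono[OF assms(1)] by simp
  then show len: "2 \<le> length xs" by (metis S size_mset)
  then obtain x0 x1 r where xs: "xs = x0 # x1 # r"
    by (cases xs; cases "tl xs") auto
  have "sorted (rev xs)" by (simp add: xs_def)
  then have le: "\<forall>y\<in>set r. y \<le> x1"
    by (auto simp: xs sorted_append)
  show "min a b \<le> xs ! 1"
  proof (rule ccontr)
    assume "\<not> min a b \<le> xs ! 1"
    then have x1: "\<not> min a b \<le> x1" by (simp add: xs)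
    define P where "P y \<longleftrightarrow> min a b \<le> y" for y
    have "\<not> P x1" "filter P r = []"
      using x1 le unfolding P_def filter_empty_conv by (blast intro: order_trans)+
    then have "size (filter_mset P S) \<le> 1"
      by (simp add: S[symmetric] xs flip: mset_filter)
    moreover have "filter_mset P {#a, b#} \<subseteq># filter_mset P S"
      using assms(1) by (rule multiset_filter_mono)
    then have "2 \<le> size (filter_mset P S)"
      using size_mset_mono by (fastforce simp: P_def)
    ultimately show False by simp
  qed
qed

lemma count_singular_values:
  fixes A :: "real^'u^'v"
  assumes "singular_value A \<sigma>"
  shows "count (singular_values A) \<sigma> = dim (gram_eigenspace A \<sigma>)"
proof -
  have "count (singular_values A) \<sigma> =
      (\<Sum>\<tau>\<in>{\<tau>. singular_value A \<tau>}. if \<sigma> = \<tau> then dim (gram_eigenspace A \<tau>) else 0)"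
    by (simp add: singular_values_def count_sum)
  also have "\<dots> = dim (gram_eigenspace A \<sigma>)"
    using assms finite_singular_values[of A] by (simp add: sum.delta)
  finally show ?thesis .
qed

text \<open>For \<sigma> = \<tau> the inclusion demands multiplicity two; orthogonality supplies it,
  since nonzero orthogonal vectors are independent and both lie in the same eigenspace.\<close>

lemma orthogonal_eigenvectors_subset_singular_values:
  fixes A :: "real^'u^'v"
  assumes "0 \<le> \<sigma>" "v \<noteq> 0" "v \<in> gram_eigenspace A \<sigma>"
    and "0 \<le> \<tau>" "w \<noteq> 0" "w \<in> gram_eigenspace A \<tau>"
    and "orthogonal v w"
  shows "{#\<sigma>, \<tau>#} \<subseteq># singular_values A"
proof -
  have sv: "singular_value A \<sigma>" "singular_value A \<tau>"
    using assms by (auto simp: singular_value_def)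
  have neq: "v \<noteq> w"
    using assms by (auto simp: orthogonal_self)
  have pos: "1 \<le> dim (gram_eigenspace A \<rho>)" if "u \<noteq> 0" "u \<in> gram_eigenspace A \<rho>" for u \<rho>
    using independent_card_le_dim[of "{u}" "gram_eigenspace A \<rho>"] that by auto
  have "2 \<le> dim (gram_eigenspace A \<sigma>)" if "\<tau> = \<sigma>"
  proof -
    have "independent {v, w}"
      by (rule pairwise_orthogonal_independent)
        (use assms in \<open>auto simp: pairwise_def orthogonal_commute\<close>)
    then show ?thesis
      using independent_card_le_dim[of "{v, w}" "gram_eigenspace A \<sigma>"] assms neq that by auto
  qed
  then show ?thesis
    using count_singular_values[OF sv(1)] count_singular_values[OF sv(2)]
      pos[OF assms(2,3)] pos[OF assms(5,6)]
    by (auto simp: subseteq_mset_def simp flip: count_greater_zero_iff)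
qed

lemma inner_gram_matrix:
  fixes A :: "real^'u^'v"
  shows "((A ** transpose A) *v x) \<bullet> y = (transpose A *v x) \<bullet> (transpose A *v y)"
  by (metis dot_lmul_matrix inner_commute matrix_vector_mul_assoc transpose_matrix_vector transpose_transpose)

text \<open>Variational argument: a maximiser \<open>x\<close> of \<open>q\<close> on the unit
  sphere of the complement of \<open>e\<close> is itself an eigenvector of the Gram matrix. Its
  singular value \<open>m\<close> and \<sigma> then occupy two places in the multiset, and
  \<open>m\<close> is the smaller one because \<sigma> bounds the operator norm.\<close>

lemma norm_le_second_singular_value:
  fixes A :: "real^'u^'v"
  assumes e: "e \<noteq> 0" "e \<in> gram_eigenspace A \<sigma>"
    and top: "\<And>w. norm (transpose A *v w) \<le> \<sigma> * norm w"
    and w: "orthogonal e w"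
  shows "norm (transpose A *v w) \<le> second_singular_value A * norm w"
proof (cases "w = 0")
  case False
  define q where "q x = (transpose A *v x) \<bullet> (transpose A *v x)" for x
  define C where "C = {x. e \<bullet> x = 0} \<inter> sphere 0 1"
  have "0 \<le> \<sigma> * norm e"
    using order_trans[OF norm_ge_zero top] .
  with e have \<sigma>: "0 \<le> \<sigma>"
    by (simp add: zero_le_mult_iff)
  \<comment> \<open>The Gram matrix is symmetric, so it maps the complement of its eigenvector
    \<open>e\<close> into itself; this keeps the residual \<open>z\<close> below orthogonal to
    \<open>e\<close>.\<close>
  have Be: "((A ** transpose A) *v x) \<bullet> e = \<sigma>\<^sup>2 * (x \<bullet> e)" for x
    using e(2) inner_gram_matrix[of A x e] inner_gram_matrix[of A e x]
    by (simp add: gram_eigenspace_def inner_commute)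
  have "compact C"
    unfolding C_def by (intro closed_Int_compact closed_hyperplane compact_sphere)
  moreover have "w /\<^sub>R norm w \<in> C"
    using w False by (simp add: C_def orthogonal_def)
  then have "C \<noteq> {}" by blast
  moreover have "continuous_on C q"
    unfolding q_def
    by (intro continuous_intros linear_continuous_on linear_conv_bounded_linear[THEN iffD1])
  ultimately obtain x where x: "x \<in> C" "\<And>y. y \<in> C \<Longrightarrow> q y \<le> q x"
    using continuous_attains_sup by metis
  have x1: "x \<bullet> x = 1" "e \<bullet> x = 0"
    using x(1) by (auto simp: C_def dot_square_norm)
  define m where "m = norm (transpose A *v x)"
  have qx: "q x = m\<^sup>2"
    by (simp add: q_def m_def dot_square_norm)
  have qle: "q y \<le> m\<^sup>2 * (y \<bullet> y)" if "e \<bullet> y = 0" for y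
  proof (cases "y = 0")
    case y: False
    then have "y /\<^sub>R norm y \<in> C" using that by (simp add: C_def)
    then have "q (y /\<^sub>R norm y) \<le> m\<^sup>2" using x(2) qx by metis
    moreover have "q (y /\<^sub>R norm y) = q y / (y \<bullet> y)"
      by (simp add: q_def matrix_vector_mult_scaleR dot_square_norm divide_inverse power2_eq_square)
    ultimately show ?thesis using y by (simp add: divide_le_eq)
  qed (simp add: q_def)
  \<comment> \<open>\<open>z\<close> is the residual of the eigenvector equation at
    \<open>x\<close>, so the aim is \<open>z = 0\<close>. It also serves as the direction in which
    \<open>x\<close> is perturbed.\<close>
  define z where "z = (A ** transpose A) *v x - m\<^sup>2 *\<^sub>R x"
  have ez: "e \<bullet> z = 0"
    using Be[of x] x1 by (simp add: z_def inner_diff_right inner_commute)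
  have zz: "(transpose A *v x) \<bullet> (transpose A *v z) - m\<^sup>2 * (x \<bullet> z) = z \<bullet> z"
    unfolding inner_gram_matrix[symmetric] by (metis z_def inner_diff_left inner_scaleR_left)
  \<comment> \<open>First-order optimality of \<open>x\<close>: the gap \<open>m\<^sup>2 (y \<bullet> y) - q y\<close> vanishes at \<open>x\<close> and stays
    nonnegative along \<open>x + t z\<close>.\<close>
  have ineq: "0 \<le> t\<^sup>2 * (m\<^sup>2 * (z \<bullet> z) - q z) - 2 * t * (z \<bullet> z)" for t
  proof -
    have "q (x + t *\<^sub>R z) \<le> m\<^sup>2 * ((x + t *\<^sub>R z) \<bullet> (x + t *\<^sub>R z))"
      by (rule qle) (simp add: inner_add_right x1 ez)
    moreover have "q (x + t *\<^sub>R z) =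
        m\<^sup>2 + 2 * t * ((transpose A *v x) \<bullet> (transpose A *v z)) + t\<^sup>2 * q z"
      using qx by (simp add: q_def matrix_vector_right_distrib matrix_vector_mult_scaleR inner_add_left
          inner_add_right inner_commute power2_eq_square algebra_simps)
    moreover have "(x + t *\<^sub>R z) \<bullet> (x + t *\<^sub>R z) = 1 + 2 * t * (x \<bullet> z) + t\<^sup>2 * (z \<bullet> z)"
      using x1 by (simp add: inner_add_left inner_add_right inner_commute power2_eq_square algebra_simps)
    ultimately have "m\<^sup>2 + 2 * t * ((transpose A *v x) \<bullet> (transpose A *v z)) + t\<^sup>2 * q z
        \<le> m\<^sup>2 * (1 + 2 * t * (x \<bullet> z) + t\<^sup>2 * (z \<bullet> z))"
      by (simp only:)
    moreover have "(transpose A *v x) \<bullet> (transpose A *v z) = z \<bullet> z + m\<^sup>2 * (x \<bullet> z)"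
      using zz by simp
    ultimately show ?thesis
      by (simp only: algebra_simps)
  qed
  have "z \<bullet> z = 0"
  proof (rule ccontr)
    assume "z \<bullet> z \<noteq> 0"
    then have pos: "0 < z \<bullet> z" using inner_ge_zero[of z] by linarith
    define k where "k = m\<^sup>2 * (z \<bullet> z) - q z"
    \<comment> \<open>For a small positive \<open>t\<close> the linear term of \<open>ineq\<close>
      dominates. This choice gives \<open>t * k \<le> z \<bullet> z\<close>, and the
      \<open>+ 1\<close> keeps the denominator positive when \<open>k = 0\<close>.\<close>
    define t where "t = (z \<bullet> z) / (k + 1)"
    have k: "0 \<le> k" using qle[OF ez] by (simp add: k_def)
    then have t: "0 < t" using pos by (simp add: t_def)
    have "t * k \<le> z \<bullet> z" using pos k by (simp add: t_def field_simps)
    then have "t * (t * k) \<le> t * (z \<bullet> z)" using t by (intro mult_left_mono) auto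
    moreover have "0 < t * (z \<bullet> z)" using t pos by simp
    ultimately show False
      using ineq[of t] by (simp add: k_def power2_eq_square algebra_simps)
  qed
  then have "x \<in> gram_eigenspace A m"
    by (simp add: z_def gram_eigenspace_def)
  moreover have "x \<noteq> 0" using x1 by auto
  moreover have "0 \<le> m" by (simp add: m_def)
  ultimately have "{#\<sigma>, m#} \<subseteq># singular_values A"
    using e \<sigma> x1 by (intro orthogonal_eigenvectors_subset_singular_values) (auto simp: orthogonal_def)
  from min_le_second_of_sorted_list[OF this] have "min \<sigma> m \<le> second_singular_value A"
    by (simp add: second_singular_value_def Let_def)
  moreover have "m \<le> \<sigma>"
    using top[of x] x1 by (simp add: m_def norm_eq_sqrt_inner)
  ultimately have m: "m \<le> second_singular_value A" by simp
  have "(norm (transpose A *v w))\<^sup>2 \<le> (m * norm w)\<^sup>2"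
    using qle[of w] w by (simp add: q_def dot_square_norm orthogonal_def power_mult_distrib)
  then have "norm (transpose A *v w) \<le> m * norm w"
    by (rule power2_le_imp_le) (simp add: m_def)
  also have "\<dots> \<le> second_singular_value A * norm w"
    using m by (intro mult_right_mono) auto
  finally show ?thesis .
qed (simp add: matrix_vector_mult_0_right)

section \<open>Bipartite expanders\<close>

lemma norm_vec_squared:
  fixes z :: "real^'i"
  shows "(norm z)\<^sup>2 = (\<Sum>i\<in>UNIV. (z $ i)\<^sup>2)"
  by (simp add: norm_vec_def L2_set_def sum_nonneg)

text \<open>The factors \<open>CARD('v)\<close> of the two vertex weights cancel, so an entry on an
  edge depends only on \<open>d\<close> and the outer degree, which that edge makes
  positive.\<close>

lemma normalized_adjacency_nth:
  assumes "inner_regular d E"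
  shows "normalized_adjacency d E $ v $ u =
    (if u \<in> nbrs_inner E v then 1 / sqrt (real d * real (card (nbrs_outer E u))) else 0)"
proof (cases "u \<in> nbrs_inner E v")
  case True
  then have "v \<in> nbrs_outer E u" by (simp add: nbrs_inner_def nbrs_outer_def)
  then have "0 < real (card (nbrs_outer E u))"
    by (metis card_gt_0_iff empty_iff finite of_nat_0_less_iff)
  moreover define a where "a = sqrt (real d)"
  moreover have "real d = a * a" "0 < a"
    using assms by (auto simp: a_def inner_regular_def)
  ultimately show ?thesis
    using True by (simp add: normalized_adjacency_def inner_weight_def outer_weight_def
        real_sqrt_divide real_sqrt_mult)
qed (simp add: normalized_adjacency_def)

lemma sum_nbrs_outer_swap:
  fixes E :: "('u::finite, 'v::finite) bigraph"
  shows "(\<Sum>u\<in>UNIV. \<Sum>v\<in>nbrs_outer E u. h u v) = (\<Sum>v\<in>UNIV. \<Sum>u\<in>nbrs_inner E v. h u v)"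
  using sum.swap_restrict[of UNIV UNIV h "\<lambda>u v. (u, v) \<in> E"]
  by (simp add: nbrs_outer_def nbrs_inner_def)

lemma transpose_normalized_adjacency_mult_nth:
  fixes E :: "('u::finite, 'v::finite) bigraph"
  assumes "inner_regular d E"
  shows "(transpose (normalized_adjacency d E) *v w) $ u =
    (\<Sum>v\<in>nbrs_outer E u. w $ v) / sqrt (real d * real (card (nbrs_outer E u)))"
proof -
  have "(transpose (normalized_adjacency d E) *v w) $ u =
      (\<Sum>v\<in>UNIV. if v \<in> nbrs_outer E u
        then w $ v / sqrt (real d * real (card (nbrs_outer E u))) else 0)"
    by (simp add: matrix_vector_mult_def transpose_def normalized_adjacency_nth[OF assms]
        nbrs_outer_def nbrs_inner_def if_distrib cong: if_cong del: transpose_matrix_vector)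
      (rule sum.cong, auto)
  then show ?thesis
    by (simp add: sum.If_cases sum_divide_distrib)
qed

lemma normalized_adjacency_mult_nth:
  fixes E :: "('u::finite, 'v::finite) bigraph"
  assumes "inner_regular d E"
  shows "(normalized_adjacency d E *v y) $ v =
    (\<Sum>u\<in>nbrs_inner E v. y $ u / sqrt (real d * real (card (nbrs_outer E u))))"
proof -
  have "(normalized_adjacency d E *v y) $ v =
      (\<Sum>u\<in>UNIV. if u \<in> nbrs_inner E v
        then y $ u / sqrt (real d * real (card (nbrs_outer E u))) else 0)"
    unfolding matrix_vector_mult_def
    by (simp add: normalized_adjacency_nth[OF assms]) (rule sum.cong, auto)
  then show ?thesis
    by (simp add: sum.If_cases)
qed

text \<open>Cauchy-Schwarz at each outer vertex cancels the outer degree; summing over edges then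
  counts each inner vertex \<open>d\<close> times, cancelling \<open>1 / d\<close>. This is the
  premise \<open>top\<close> of the variational lemma, with top singular value 1.\<close>

lemma norm_transpose_normalized_adjacency_le:
  fixes E :: "('u::finite, 'v::finite) bigraph"
  assumes reg: "inner_regular d E"
  shows "norm (transpose (normalized_adjacency d E) *v w) \<le> norm w"
proof -
  let ?y = "transpose (normalized_adjacency d E) *v w"
  let ?k = "\<lambda>u. real (card (nbrs_outer E u))"
  have d: "0 < real d" using reg by (simp add: inner_regular_def)
  have bound: "(?y $ u)\<^sup>2 \<le> (\<Sum>v\<in>nbrs_outer E u. (w $ v)\<^sup>2 / d)" for u
  proof (cases "?k u = 0")
    case True
    then show ?thesis using d
      by (simp add: transpose_normalized_adjacency_mult_nth[OF reg] del: transpose_matrix_vector)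
  next
    case False
    then have k: "0 < ?k u"
      using of_nat_0_le_iff[of "card (nbrs_outer E u)"] by linarith
    have "(?y $ u)\<^sup>2 = (\<Sum>v\<in>nbrs_outer E u. w $ v)\<^sup>2 / (d * ?k u)"
      using d by (simp add: transpose_normalized_adjacency_mult_nth[OF reg] power_divide
          del: transpose_matrix_vector)
    also have "\<dots> \<le> ((\<Sum>v\<in>nbrs_outer E u. (w $ v)\<^sup>2) * ?k u) / (d * ?k u)"
      using d k by (intro divide_right_mono sum_squared_le_sum_of_squares) auto
    also have "\<dots> = (\<Sum>v\<in>nbrs_outer E u. (w $ v)\<^sup>2 / d)"
      using k by (simp add: sum_divide_distrib)
    finally show ?thesis .
  qed
  have "(norm ?y)\<^sup>2 \<le> (\<Sum>u\<in>UNIV. \<Sum>v\<in>nbrs_outer E u. (w $ v)\<^sup>2 / d)"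
    unfolding norm_vec_squared by (intro sum_mono bound)
  also have "\<dots> = (norm w)\<^sup>2"
    using reg by (simp add: sum_nbrs_outer_swap norm_vec_squared inner_regular_def)
  finally show ?thesis
    by (rule power2_le_imp_le) simp
qed

text \<open>The Gram matrix is the transition matrix of the two-step walk inner - outer - inner,
  which fixes constants. Hence the second singular value controls the vectors of mean zero.\<close>

lemma one_in_gram_eigenspace_normalized_adjacency:
  fixes E :: "('u::finite, 'v::finite) bigraph"
  assumes reg: "inner_regular d E"
  shows "1 \<in> gram_eigenspace (normalized_adjacency d E) 1"
proof -
  have d: "0 < real d" using reg by (simp add: inner_regular_def)
  have "(normalized_adjacency d E *v (transpose (normalized_adjacency d E) *v 1)) $ v = 1" for v
  proof -
    have "(\<Sum>v\<in>nbrs_outer E u. 1 $ v) / sqrt (real d * real (card (nbrs_outer E u))) /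
        sqrt (real d * real (card (nbrs_outer E u))) = 1 / d" if "u \<in> nbrs_inner E v" for u
    proof -
      have "v \<in> nbrs_outer E u" using that by (simp add: nbrs_inner_def nbrs_outer_def)
      then have "0 < real (card (nbrs_outer E u))"
        by (metis card_gt_0_iff empty_iff finite of_nat_0_less_iff)
      moreover have "sqrt (real d * real (card (nbrs_outer E u))) *
          sqrt (real d * real (card (nbrs_outer E u))) = real d * real (card (nbrs_outer E u))"
        using d by simp
      ultimately show ?thesis
        unfolding divide_divide_eq_left by (auto simp: card_gt_0_iff)
    qed
    then have "(normalized_adjacency d E *v (transpose (normalized_adjacency d E) *v 1)) $ v =
        (\<Sum>u\<in>nbrs_inner E v. 1 / d)"
      unfolding normalized_adjacency_mult_nth[OF reg] transpose_normalized_adjacency_mult_nth[OF reg]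
      by (intro sum.cong) auto
    then show ?thesis using reg d by (simp add: inner_regular_def)
  qed
  then show ?thesis
    by (simp add: gram_eigenspace_def vec_eq_iff matrix_vector_mul_assoc[symmetric]
        del: transpose_matrix_vector)
qed

text \<open>The centred vector \<open>w\<close> is orthogonal to the constants, and \<phi> is the
  image of \<open>y\<close> under the adjacency matrix. So the squared norm of \<open>w\<close>
  equals its inner product with \<phi>, which moves to
  \<open>y \<bullet> (transpose ?A *v w)\<close>; Cauchy-Schwarz and the spectral gap bound this,
  and one factor \<open>norm w\<close> cancels.\<close>

lemma spectral_expander_variance_le:
  fixes E :: "('u::finite, 'v::finite) bigraph"
  assumes exp: "spectral_expander d l E" and K: "l \<le> K" "0 \<le> K"
    and F: "\<And>u. 0 \<le> F u" "\<And>u. F u \<le> 1"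
  defines "\<phi> \<equiv> \<lambda>v. (\<Sum>u\<in>nbrs_inner E v. F u) / real d"
  defines "\<alpha> \<equiv> (\<Sum>v\<in>UNIV. \<phi> v) / real CARD('v)"
  shows "(\<Sum>v\<in>UNIV. (\<phi> v - \<alpha>)\<^sup>2) / real CARD('v) \<le> K\<^sup>2 * \<alpha>"
proof -
  let ?A = "normalized_adjacency d E"
  let ?n = "real CARD('v)"
  let ?k = "\<lambda>u. real (card (nbrs_outer E u))"
  have reg: "inner_regular d E" and l: "second_singular_value ?A \<le> l"
    using exp by (auto simp: spectral_expander_def)
  have d: "0 < real d" using reg by (simp add: inner_regular_def)
  define w :: "real^'v" where "w = (\<chi> v. \<phi> v - \<alpha>)"
  \<comment> \<open>The weight turns each matrix entry \<open>1 / sqrt (d * ?k u)\<close> into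
    \<open>1 / d\<close>, so that \<open>?A *v y\<close> has entries
    \<open>\<phi> v\<close>.\<close>
  define y :: "real^'u" where "y = (\<chi> u. F u * sqrt (?k u / d))"
  have sum_w: "(\<Sum>v\<in>UNIV. w $ v) = 0"
    by (simp add: w_def \<alpha>_def sum_subtractf)
  then have "orthogonal 1 w"
    by (simp add: orthogonal_def inner_vec_def)
  then have "norm (transpose ?A *v w) \<le> second_singular_value ?A * norm w"
    using norm_transpose_normalized_adjacency_le[OF reg]
    by (intro norm_le_second_singular_value[OF _ one_in_gram_eigenspace_normalized_adjacency[OF reg]])
      (auto simp del: transpose_matrix_vector)
  also have "\<dots> \<le> K * norm w"
    using l K by (intro mult_right_mono) auto
  finally have Aw: "norm (transpose ?A *v w) \<le> K * norm w" .
  \<comment> \<open>Since \<open>w\<close> sums to zero, one of its two factors may be replaced by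
    \<phi>.\<close>
  have "(norm w)\<^sup>2 = (\<Sum>v\<in>UNIV. w $ v * \<phi> v) - \<alpha> * (\<Sum>v\<in>UNIV. w $ v)"
    unfolding norm_vec_squared sum_distrib_left sum_subtractf[symmetric]
    by (simp add: w_def power2_eq_square algebra_simps)
  also have "\<dots> = (\<Sum>v\<in>UNIV. \<Sum>u\<in>nbrs_inner E v. w $ v * F u / d)"
    by (simp add: sum_w \<phi>_def sum_distrib_left sum_divide_distrib)
  also have "\<dots> = (\<Sum>u\<in>UNIV. \<Sum>v\<in>nbrs_outer E u. w $ v * F u / d)"
    by (rule sum_nbrs_outer_swap[symmetric])
  also have "\<dots> = y \<bullet> (transpose ?A *v w)"
    unfolding inner_vec_def
  proof (rule sum.cong, rule refl)
    fix u
    have "(\<Sum>v\<in>nbrs_outer E u. w $ v * F u / d) = F u / d * (\<Sum>v\<in>nbrs_outer E u. w $ v)"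
      by (simp add: sum_distrib_left mult.commute)
    also have "\<dots> = y $ u * (transpose ?A *v w) $ u"
    \<comment> \<open>Outer vertices without neighbours contribute zero on both sides; the quotient
      of square roots equals \<open>1 / d\<close> only at positive degree.\<close>
    proof (cases "?k u = 0")
      case False
      then have "sqrt (?k u / d) / sqrt (d * ?k u) = 1 / d"
        using d by (simp add: real_sqrt_divide real_sqrt_mult field_simps)
      then have "F u / d * c = F u * (sqrt (?k u / d) / sqrt (d * ?k u)) * c" for c
        by simp
      then show ?thesis
        unfolding transpose_normalized_adjacency_mult_nth[OF reg] y_def by simp
    qed (simp add: y_def)
    finally show "(\<Sum>v\<in>nbrs_outer E u. w $ v * F u / d) = y $ u \<bullet> (transpose ?A *v w) $ u"
      by (simp del: transpose_matrix_vector)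
  qed
  also have "\<dots> \<le> norm y * (K * norm w)"
    using norm_cauchy_schwarz mult_left_mono[OF Aw norm_ge_zero] by (rule order_trans)
  finally have "norm w * norm w \<le> norm w * (K * norm y)"
    by (simp add: power2_eq_square algebra_simps)
  then have "norm w \<le> K * norm y"
    using K by (cases "w = 0") auto
  then have "(norm w)\<^sup>2 \<le> K\<^sup>2 * (norm y)\<^sup>2"
    using power_mono[of "norm w" "K * norm y" 2] by (simp add: power_mult_distrib)
  \<comment> \<open>\<open>(F u)\<^sup>2 \<le> F u\<close> on [0, 1] makes the variance bound
    proportional to the mean \<alpha>, which the final estimate exploits.\<close>
  also have "(norm y)\<^sup>2 \<le> ?n * \<alpha>"
  proof -
    have "(norm y)\<^sup>2 \<le> (\<Sum>u\<in>UNIV. F u * (?k u / d))"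
      unfolding norm_vec_squared
    proof (rule sum_mono)
      fix u
      have "(y $ u)\<^sup>2 = (F u)\<^sup>2 * (?k u / d)"
        using d by (simp add: y_def power_mult_distrib)
      also have "\<dots> \<le> F u * (?k u / d)"
        using F[of u] d by (intro mult_right_mono) (auto simp: power2_eq_square mult_left_le)
      finally show "(y $ u)\<^sup>2 \<le> F u * (?k u / d)" .
    qed
    also have "\<dots> = (\<Sum>u\<in>UNIV. \<Sum>v\<in>nbrs_outer E u. F u / d)"
      by (simp add: mult.commute)
    also have "\<dots> = (\<Sum>v\<in>UNIV. \<phi> v)"
      unfolding sum_nbrs_outer_swap by (simp add: \<phi>_def sum_divide_distrib)
    also have "\<dots> = ?n * \<alpha>"
      by (simp add: \<alpha>_def)
    finally show ?thesis .
  qed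
  finally have "(norm w)\<^sup>2 \<le> K\<^sup>2 * (?n * \<alpha>)"
    using K by (simp add: mult_left_mono)
  then show ?thesis
    by (simp add: norm_vec_squared w_def field_simps)
qed

section \<open>Games and induced substrategies\<close>

lemma sum_bilinear_swap:
  fixes c :: "'a \<Rightarrow> 'b \<Rightarrow> real"
  shows "(\<Sum>s\<in>S. \<Sum>t\<in>T. \<Sum>a\<in>A. \<Sum>b\<in>B. c a b * \<phi> s a * \<psi> t b) =
    (\<Sum>a\<in>A. \<Sum>b\<in>B. c a b * (\<Sum>s\<in>S. \<phi> s a) * (\<Sum>t\<in>T. \<psi> t b))"
proof -
  have "(\<Sum>s\<in>S. \<Sum>t\<in>T. \<Sum>a\<in>A. \<Sum>b\<in>B. c a b * \<phi> s a * \<psi> t b) =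
      (\<Sum>(s, t)\<in>S \<times> T. \<Sum>(a, b)\<in>A \<times> B. c a b * \<phi> s a * \<psi> t b)"
    by (simp only: sum.cartesian_product[symmetric])
  also have "\<dots> = (\<Sum>(a, b)\<in>A \<times> B. \<Sum>(s, t)\<in>S \<times> T. c a b * \<phi> s a * \<psi> t b)"
    unfolding case_prod_unfold by (rule sum.swap)
  also have "\<dots> = (\<Sum>a\<in>A. \<Sum>b\<in>B. \<Sum>s\<in>S. \<Sum>t\<in>T. c a b * \<phi> s a * \<psi> t b)"
    by (simp only: sum.cartesian_product[symmetric])
  also have "\<dots> = (\<Sum>a\<in>A. \<Sum>b\<in>B. c a b * (\<Sum>s\<in>S. \<phi> s a) * (\<Sum>t\<in>T. \<psi> t b))"
    unfolding mult.assoc sum_product by (simp only: sum_distrib_left)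
  finally show ?thesis .
qed

text \<open>Inserting the indicators of \<open>p s = a\<close> and \<open>q t = b\<close> reduces
  this to exchanging sums. In the application \<open>p\<close> and \<open>q\<close> evaluate answer
  maps at the question actually asked.\<close>

lemma sum_bilinear_fibres:
  fixes c :: "'a::finite \<Rightarrow> 'b::finite \<Rightarrow> real"
  assumes "finite S" "finite T"
  shows "(\<Sum>s\<in>S. \<Sum>t\<in>T. c (p s) (q t) * f s * g t) =
    (\<Sum>a\<in>UNIV. \<Sum>b\<in>UNIV. c a b * (\<Sum>s | s \<in> S \<and> p s = a. f s) * (\<Sum>t | t \<in> T \<and> q t = b. g t))"
proof -
  have "(\<Sum>a\<in>UNIV. \<Sum>b\<in>UNIV. c a b * (if p s = a then f s else 0) * (if q t = b then g t else 0)) =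
      c (p s) (q t) * f s * g t" for s t
    by (simp add: if_distrib[where f = "\<lambda>z. z * _"] if_distrib[where f = "\<lambda>z. _ * z"] cong: if_cong)
  then have "(\<Sum>s\<in>S. \<Sum>t\<in>T. c (p s) (q t) * f s * g t) =
      (\<Sum>s\<in>S. \<Sum>t\<in>T. \<Sum>a\<in>UNIV. \<Sum>b\<in>UNIV.
        c a b * (if p s = a then f s else 0) * (if q t = b then g t else 0))"
    by simp
  then show ?thesis
    unfolding sum_bilinear_swap using assms by (simp add: sum.inter_filter)
qed

lemma finite_answer_maps: "finite (answer_maps (E :: ('u, 'v::finite) bigraph) u :: ('v \<Rightarrow> 'a::finite) set)"
  by (simp add: answer_maps_def finite_PiE)

lemma inner_regular_nbrs:
  assumes "inner_regular d E"
  shows "card (nbrs_inner E v) = d" "nbrs_inner E v \<noteq> {}"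
  using assms by (auto simp: inner_regular_def dest: spec[of _ v])

lemma induced_eq:
  fixes E :: "('u::finite, 'v::finite) bigraph"
  assumes "inner_regular d E"
  shows "induced E f v a =
    (\<Sum>u\<in>nbrs_inner E v. \<Sum>a' | a' \<in> answer_maps E u \<and> a' v = a. f u a') / real d"
  using inner_regular_nbrs[OF assms, of v] by (simp add: induced_def integral_pmf_of_set)

text \<open>The fibres of evaluation at \<open>v\<close> partition the answer maps, so the induced
  total is a neighbour average of outer totals, the form required by the variance bound.\<close>

lemma total_induced:
  fixes E :: "('u::finite, 'v::finite) bigraph"
  assumes "inner_regular d E"
  shows "total (induced E f) v = (\<Sum>u\<in>nbrs_inner E v. \<Sum>a'\<in>answer_maps E u. f u a') / real d"
proof -
  have "(\<Sum>a\<in>UNIV. \<Sum>a' | a' \<in> answer_maps E u \<and> a' v = a. f u a') = (\<Sum>a'\<in>answer_maps E u. f u a')" for u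
    by (rule sum.group) (auto simp: finite_answer_maps)
  then show ?thesis
    unfolding total_def induced_eq[OF assms] sum_divide_distrib[symmetric]
    by (subst sum.swap) simp
qed

lemma induced_nonneg:
  fixes E :: "('u::finite, 'v::finite) bigraph"
  assumes "inner_regular d E" "concat_substrategy E f"
  shows "0 \<le> induced E f v a"
  using assms by (auto simp: induced_eq concat_substrategy_def intro!: divide_nonneg_nonneg sum_nonneg)

lemma concat_value_eq_strategy_value_induced:
  fixes M :: "('u::finite, 'x::finite) bigraph" and P :: "('w::finite, 'y::finite) bigraph"
    and G :: "('x, 'y, 'a::finite, 'b::finite) game"
  assumes "inner_regular dM M" "inner_regular dP P"
  shows "concat_value M G P f g = strategy_value G (induced M f) (induced P g)"
proof -
  have "measure_pmf.expectation (pmf_of_set (nbrs_inner M x)) (\<lambda>x'.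
         measure_pmf.expectation (pmf_of_set (nbrs_inner P y)) (\<lambda>y'.
           \<Sum>a'\<in>answer_maps M x'. \<Sum>b'\<in>answer_maps P y'.
             of_bool (wins G (a' x) (b' y) x y) * f x' a' * g y' b')) =
      (\<Sum>a\<in>UNIV. \<Sum>b\<in>UNIV. of_bool (wins G a b x y) * induced M f x a * induced P g y b)" for x y
  proof -
    have "(\<Sum>a'\<in>answer_maps M x'. \<Sum>b'\<in>answer_maps P y'.
             of_bool (wins G (a' x) (b' y) x y) * f x' a' * g y' b') =
        (\<Sum>a\<in>UNIV. \<Sum>b\<in>UNIV. of_bool (wins G a b x y) *
          (\<Sum>a' | a' \<in> answer_maps M x' \<and> a' x = a. f x' a') *
          (\<Sum>b' | b' \<in> answer_maps P y' \<and> b' y = b. g y' b'))" for x' y'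
      by (rule sum_bilinear_fibres[OF finite_answer_maps finite_answer_maps])
    then show ?thesis
      using inner_regular_nbrs[OF assms(1), of x] inner_regular_nbrs[OF assms(2), of y]
      by (simp add: integral_pmf_of_set induced_eq[OF assms(1)] induced_eq[OF assms(2)]
          sum_bilinear_swap sum_divide_distrib[symmetric])
  qed
  then show ?thesis
    by (simp add: concat_value_def strategy_value_def)
qed

lemma sum_of_bool_mult_bounds:
  fixes r :: "'a::finite \<Rightarrow> real" and s :: "'b::finite \<Rightarrow> real"
  assumes "\<And>a. 0 \<le> r a" "\<And>b. 0 \<le> s b" "sum r UNIV = 1" "sum s UNIV = 1"
  shows "(\<Sum>a\<in>UNIV. \<Sum>b\<in>UNIV. of_bool (Q a b) * r a * s b) \<in> {0..1}"
proof -
  have "(\<Sum>a\<in>UNIV. \<Sum>b\<in>UNIV. of_bool (Q a b) * r a * s b) \<le> (\<Sum>a\<in>UNIV. \<Sum>b\<in>UNIV. r a * s b)"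
    using assms by (intro sum_mono) (auto simp: of_bool_def)
  also have "\<dots> = 1"
    using assms by (simp add: sum_product[symmetric])
  finally show ?thesis
    using assms by (auto intro!: sum_nonneg)
qed

section \<open>Complete strategies and the value of a game\<close>

lemma complete_strategyD:
  assumes "complete_strategy f"
  shows "0 \<le> f q a" "(\<Sum>a\<in>UNIV. f q a) = 1"
  using assms by (auto simp: complete_strategy_def substrategy_def total_def)

lemma complete_strategyI:
  assumes "\<And>q a. 0 \<le> f q a" "\<And>q. total f q = 1"
  shows "complete_strategy f"
proof -
  have "f q a \<le> 1" for q a
    using member_le_sum[of a UNIV "f q"] assms by (simp add: total_def)
  then show ?thesis
    using assms by (simp add: complete_strategy_def substrategy_def)
qed

text \<open>Provides the boundedness that the supremum in \<open>game_value\<close> requires, and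
  later places that supremum in [0, 1].\<close>

lemma strategy_value_bounds:
  fixes G :: "('x::finite, 'y::finite, 'a::finite, 'b::finite) game"
  assumes "complete_strategy f" "complete_strategy g"
  shows "strategy_value G f g \<in> {0..1}"
proof -
  have W: "(case z of (x, y) \<Rightarrow> \<Sum>a\<in>UNIV. \<Sum>b\<in>UNIV. of_bool (wins G a b x y) * f x a * g y b) \<in> {0..1}" for z
    unfolding case_prod_unfold
    by (rule sum_of_bool_mult_bounds)
      (simp_all add: complete_strategyD[OF assms(1)] complete_strategyD[OF assms(2)])
  have "strategy_value G f g \<le> measure_pmf.expectation (questions G) (\<lambda>_. 1)"
    unfolding strategy_value_def
    by (rule integral_mono) (use W in \<open>auto simp: integrable_measure_pmf_finite\<close>)
  moreover have "0 \<le> strategy_value G f g"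
    unfolding strategy_value_def by (rule Bochner_Integration.integral_nonneg) (use W in auto)
  ultimately show ?thesis by simp
qed

lemma strategy_value_le_game_value:
  fixes G :: "('x::finite, 'y::finite, 'a::finite, 'b::finite) game"
  assumes "complete_strategy f" "complete_strategy g"
  shows "strategy_value G f g \<le> game_value G"
  unfolding game_value_def
  by (rule cSUP_upper2[where x = "(f, g)"])
    (use assms strategy_value_bounds in \<open>fastforce intro!: bdd_aboveI[where M = 1]\<close>)+

lemma complete_strategy_normalize:
  fixes f :: "'q \<Rightarrow> 'a::finite \<Rightarrow> real"
  assumes "\<And>q a. 0 \<le> f q a"
  obtains h where "complete_strategy h" "\<And>q a. f q a = total f q * h q a"
proof
  \<comment> \<open>Where the total vanishes, so does every \<open>f q a\<close>, and any
    distribution would do; the uniform one is taken.\<close>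
  define h where "h q a = (if total f q = 0 then 1 / real CARD('a) else f q a / total f q)" for q a
  have t: "0 \<le> total f q" for q
    using assms by (simp add: total_def sum_nonneg)
  show "complete_strategy h"
  proof (rule complete_strategyI)
    show "0 \<le> h q a" for q a
      using assms t by (simp add: h_def)
    show "total h q = 1" for q
      by (cases "total f q = 0") (simp_all add: h_def total_def sum_divide_distrib[symmetric])
  qed
  show "f q a = total f q * h q a" for q a
  proof (cases "total f q = 0")
    case True
    then have "f q a = 0"
      using assms sum_nonneg_eq_0_iff[of UNIV "f q"] by (simp add: total_def)
    then show ?thesis using True by simp
  qed (simp add: h_def)
qed

text \<open>Biregularity enters here: it identifies the moments of each induced total under the
  question distribution with the uniform averages of the spectral bound.\<close>

lemma expectation_marginals:
  fixes G :: "('x::finite, 'y::finite, 'a, 'b) game"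
  assumes "biregular G"
  shows "measure_pmf.expectation (questions G) (\<lambda>z. h (fst z)) = (\<Sum>x\<in>UNIV. h x) / real CARD('x)"
    and "measure_pmf.expectation (questions G) (\<lambda>z. k (snd z)) = (\<Sum>y\<in>UNIV. k y) / real CARD('y)"
proof -
  have "measure_pmf.expectation (questions G) (\<lambda>z. h (fst z)) =
      measure_pmf.expectation (map_pmf fst (questions G)) h" by simp
  then show "measure_pmf.expectation (questions G) (\<lambda>z. h (fst z)) = (\<Sum>x\<in>UNIV. h x) / real CARD('x)"
    using assms by (simp only: biregular_def integral_pmf_of_set[OF UNIV_not_empty finite])
  have "measure_pmf.expectation (questions G) (\<lambda>z. k (snd z)) =
      measure_pmf.expectation (map_pmf snd (questions G)) k" by simp
  then show "measure_pmf.expectation (questions G) (\<lambda>z. k (snd z)) = (\<Sum>y\<in>UNIV. k y) / real CARD('y)"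
    using assms by (simp only: biregular_def integral_pmf_of_set[OF UNIV_not_empty finite])
qed

section \<open>Moment estimates for nearly constant weights\<close>

lemma expectation_abs_le_sqrt:
  fixes p :: "'z::finite pmf" and h :: "'z \<Rightarrow> real"
  assumes "measure_pmf.expectation p (\<lambda>z. (h z)\<^sup>2) \<le> c"
  shows "measure_pmf.expectation p (\<lambda>z. \<bar>h z\<bar>) \<le> sqrt c"
proof -
  have [simp]: "integrable (measure_pmf p) k" for k :: "'z \<Rightarrow> real"
    by (simp add: integrable_measure_pmf_finite)
  define m where "m = measure_pmf.expectation p (\<lambda>z. \<bar>h z\<bar>)"
  \<comment> \<open>The variance of the absolute value is nonnegative, so its squared mean is at
    most the second moment.\<close>
  have "0 \<le> measure_pmf.expectation p (\<lambda>z. (\<bar>h z\<bar> - m)\<^sup>2)" by simp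
  also have "\<dots> = measure_pmf.expectation p (\<lambda>z. (h z)\<^sup>2) - 2 * m * m + m\<^sup>2"
    by (simp add: power2_diff m_def mult.assoc mult.commute[of m])
  finally have "m\<^sup>2 \<le> c"
    using assms by (simp add: power2_eq_square)
  then show ?thesis
    unfolding m_def by (rule real_le_rsqrt)
qed

text \<open>Expand \<open>r * s * (W - v - \<epsilon>)\<close> around the means. The main term
  \<open>\<alpha> * \<beta> * (W - v)\<close> has nonpositive expectation, and
  \<open>- \<epsilon> * \<alpha> * \<beta>\<close> pays for the first-order errors. The weights may
  be correlated, so their cross term is bounded by squares instead of being factored.\<close>

lemma almost_constant_weights_estimate:
  fixes p :: "'z::finite pmf" and r s W :: "'z \<Rightarrow> real"
  defines "\<alpha> \<equiv> measure_pmf.expectation p r" and "\<beta> \<equiv> measure_pmf.expectation p s"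
  assumes \<alpha>: "\<alpha> \<in> {0..1}" and \<beta>: "\<beta> \<in> {0..1}"
    and r: "measure_pmf.expectation p (\<lambda>z. (r z - \<alpha>)\<^sup>2) \<le> K\<^sup>2 * \<alpha>"
    and s: "measure_pmf.expectation p (\<lambda>z. (s z - \<beta>)\<^sup>2) \<le> K\<^sup>2 * \<beta>"
    and W: "\<And>z. W z \<in> {0..1}" and EW: "measure_pmf.expectation p W \<le> v" and v: "v \<in> {0..1}"
    and \<epsilon>: "\<epsilon> \<in> {0..1}" and \<delta>: "\<delta> \<in> {0..1}" and K: "K = \<epsilon> / 2 * sqrt (\<delta> / 2)"
  shows "measure_pmf.expectation p (\<lambda>z. r z * s z * W z) \<le>
    (v + \<epsilon>) * measure_pmf.expectation p (\<lambda>z. r z * s z) + \<delta>"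
proof -
  let ?E = "measure_pmf.expectation p"
  have [simp]: "integrable (measure_pmf p) k" for k :: "'z \<Rightarrow> real"
    by (simp add: integrable_measure_pmf_finite)
  define a where "a z = r z - \<alpha>" for z
  define b where "b z = s z - \<beta>" for z
  have Ea: "?E a = 0" and Eb: "?E b = 0"
    by (simp_all add: a_def[abs_def] b_def[abs_def] \<alpha>_def \<beta>_def)
  have a2: "?E (\<lambda>z. (a z)\<^sup>2) \<le> K\<^sup>2 * \<alpha>" and b2: "?E (\<lambda>z. (b z)\<^sup>2) \<le> K\<^sup>2 * \<beta>"
    using r s by (simp_all add: a_def b_def)
  have K0: "0 \<le> K" using \<epsilon> \<delta> by (simp add: K)
  have a1: "?E (\<lambda>z. \<bar>a z\<bar>) \<le> K * sqrt \<alpha>" and b1: "?E (\<lambda>z. \<bar>b z\<bar>) \<le> K * sqrt \<beta>"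
    using expectation_abs_le_sqrt[OF a2] expectation_abs_le_sqrt[OF b2] K0
    by (simp_all add: real_sqrt_mult)
  \<comment> \<open>The products \<open>D * (a z * b z)\<close> and
    \<open>- \<epsilon> * (a z * b z)\<close> each cost at most
    \<open>\<bar>a z * b z\<bar>\<close>, hence coefficient 1 on both squares. The linear terms with
    \<epsilon> keep their sign because their expectations vanish.\<close>
  have pointwise: "r z * s z * W z - (v + \<epsilon>) * (r z * s z) \<le>
      \<alpha> * \<beta> * (W z - v) + \<alpha> * \<bar>b z\<bar> + \<beta> * \<bar>a z\<bar> + (a z)\<^sup>2 + (b z)\<^sup>2 - \<epsilon> * \<alpha> * \<beta> - \<epsilon> * \<alpha> * b z - \<epsilon> * \<beta> * a z"
    for z
  proof -
    define D where "D = W z - v"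
    have D: "\<bar>D\<bar> \<le> 1" using W[of z] v by (auto simp: D_def)
    have ab: "\<bar>a z * b z\<bar> \<le> ((a z)\<^sup>2 + (b z)\<^sup>2) / 2"
      using sum_squares_bound[of "\<bar>a z\<bar>" "\<bar>b z\<bar>"] by (simp add: abs_mult)
    have small: "e * t \<le> \<bar>t\<bar>" if "\<bar>e\<bar> \<le> 1" for e t :: real
    proof -
      have "e * t \<le> \<bar>e\<bar> * \<bar>t\<bar>" by (metis abs_ge_self abs_mult)
      also have "\<dots> \<le> \<bar>t\<bar>" using that by (simp add: mult_left_le_one_le)
      finally show ?thesis .
    qed
    have "D * (\<alpha> * b z) \<le> \<alpha> * \<bar>b z\<bar>" "D * (\<beta> * a z) \<le> \<beta> * \<bar>a z\<bar>" "D * (a z * b z) \<le> \<bar>a z * b z\<bar>"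
      using small[OF D, of "\<alpha> * b z"] small[OF D, of "\<beta> * a z"] small[OF D, of "a z * b z"] \<alpha> \<beta>
      by (simp_all add: abs_mult)
    moreover have "- \<epsilon> * (a z * b z) \<le> \<bar>a z * b z\<bar>"
      by (rule small) (use \<epsilon> in auto)
    moreover have "r z * s z * W z - (v + \<epsilon>) * (r z * s z) =
        \<alpha> * \<beta> * D + D * (\<alpha> * b z) + D * (\<beta> * a z) + D * (a z * b z)
        - \<epsilon> * \<alpha> * \<beta> - \<epsilon> * \<alpha> * b z - \<epsilon> * \<beta> * a z + - \<epsilon> * (a z * b z)"
      by (simp add: a_def b_def D_def algebra_simps)
    ultimately show ?thesis
      using ab by (simp add: D_def)
  qed
  have "?E (\<lambda>z. r z * s z * W z) - (v + \<epsilon>) * ?E (\<lambda>z. r z * s z) =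
      ?E (\<lambda>z. r z * s z * W z - (v + \<epsilon>) * (r z * s z))"
    by simp
  also have "\<dots> \<le> ?E (\<lambda>z. \<alpha> * \<beta> * (W z - v) + \<alpha> * \<bar>b z\<bar> + \<beta> * \<bar>a z\<bar> + (a z)\<^sup>2 + (b z)\<^sup>2
      - \<epsilon> * \<alpha> * \<beta> - \<epsilon> * \<alpha> * b z - \<epsilon> * \<beta> * a z)"
    by (rule integral_mono) (use pointwise in simp_all)
  also have "\<dots> = \<alpha> * \<beta> * (?E W - v) + \<alpha> * ?E (\<lambda>z. \<bar>b z\<bar>) + \<beta> * ?E (\<lambda>z. \<bar>a z\<bar>)
      + ?E (\<lambda>z. (a z)\<^sup>2) + ?E (\<lambda>z. (b z)\<^sup>2) - \<epsilon> * \<alpha> * \<beta>"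
    using Ea Eb by simp
  also have "\<dots> \<le> 0 + \<alpha> * (K * sqrt \<beta>) + \<beta> * (K * sqrt \<alpha>) + K\<^sup>2 * \<alpha> + K\<^sup>2 * \<beta> - \<epsilon> * \<alpha> * \<beta>"
    using \<alpha> \<beta> EW a1 b1 a2 b2
    by (intro add_mono diff_right_mono mult_left_mono mult_nonneg_nonpos) auto
  also have "\<dots> \<le> \<delta>"
  proof -
    define x where "x = sqrt \<alpha>"
    define y where "y = sqrt \<beta>"
    \<comment> \<open>In these variables \<open>K = \<epsilon> * w / 2\<close> and
      \<open>\<delta> = 2 * w\<^sup>2\<close>. The first-order terms cost at most
      \<open>w\<^sup>2\<close> beyond \<open>\<epsilon> * \<alpha> * \<beta>\<close>, and the two
      quadratic terms at most \<open>w\<^sup>2 / 4\<close> each, which fits within \<delta>.\<close>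
    define w where "w = sqrt (\<delta> / 2)"
    have xy: "\<alpha> = x\<^sup>2" "\<beta> = y\<^sup>2" "0 \<le> x" "0 \<le> y" "x \<le> 1" "y \<le> 1"
      using \<alpha> \<beta> by (auto simp: x_def y_def)
    have w: "\<delta> / 2 = w\<^sup>2" "0 \<le> w" using \<delta> by (auto simp: w_def)
    have "\<alpha> * (K * sqrt \<beta>) + \<beta> * (K * sqrt \<alpha>) = K * (x * y) * (x + y)"
      by (simp add: xy x_def[symmetric] y_def[symmetric] power2_eq_square algebra_simps)
    also have "\<dots> \<le> K * (x * y) * 2"
      using xy K0 by (intro mult_left_mono) auto
    \<comment> \<open>The factor 2 from \<open>x + y \<le> 2\<close> cancels the 2 in the
      denominator of \<open>K\<close>, leaving a product suited to AM-GM.\<close>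
    also have "\<dots> = \<epsilon> * (w * (x * y))"
      by (simp add: K w_def)
    also have "\<dots> \<le> \<epsilon> * ((w\<^sup>2 + (x * y)\<^sup>2) / 2)"
      using \<epsilon> sum_squares_bound[of w "x * y"] by (intro mult_left_mono) auto
    also have "\<dots> = (\<epsilon> * w\<^sup>2 + \<epsilon> * (x * y)\<^sup>2) / 2"
      by (simp add: distrib_left)
    also have "\<dots> \<le> w\<^sup>2 + \<epsilon> * (x * y)\<^sup>2"
    proof -
      have avg: "(A + B) / 2 \<le> C + B" if "A \<le> C" "0 \<le> B" "0 \<le> C" for A B C :: real
        using that by simp
      show ?thesis
        by (rule avg) (use \<epsilon> in \<open>auto simp: mult_left_le_one_le\<close>)
    qed
    also have "\<dots> = w\<^sup>2 + \<epsilon> * \<alpha> * \<beta>"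
      by (simp add: xy(1,2) power_mult_distrib)
    finally have 1: "\<alpha> * (K * sqrt \<beta>) + \<beta> * (K * sqrt \<alpha>) \<le> w\<^sup>2 + \<epsilon> * \<alpha> * \<beta>" .
    have "K\<^sup>2 = \<epsilon>\<^sup>2 * w\<^sup>2 / 4"
      by (simp add: K w_def power_mult_distrib power_divide)
    moreover have "\<epsilon>\<^sup>2 * w\<^sup>2 \<le> 1 * w\<^sup>2"
      using \<epsilon> by (intro mult_right_mono) (auto simp: power_le_one)
    ultimately have "K\<^sup>2 \<le> w\<^sup>2 / 4" by simp
    moreover have "K\<^sup>2 * \<alpha> \<le> K\<^sup>2" "K\<^sup>2 * \<beta> \<le> K\<^sup>2"
      using \<alpha> \<beta> by (auto intro!: mult_left_le)
    ultimately show ?thesis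
      using 1 w zero_le_power2[of w] by linarith
  qed
  finally show ?thesis by simp
qed

section \<open>Fortification from the spectral gap\<close>

lemma induced_total_estimates:
  fixes E :: "('u::finite, 'v::finite) bigraph"
  assumes exp: "spectral_expander d l E" and K: "l \<le> K" "0 \<le> K" and f: "concat_substrategy E f"
  defines "\<alpha> \<equiv> (\<Sum>v\<in>UNIV. total (induced E f) v) / real CARD('v)"
  shows "\<alpha> \<in> {0..1}"
    and "(\<Sum>v\<in>UNIV. (total (induced E f) v - \<alpha>)\<^sup>2) / real CARD('v) \<le> K\<^sup>2 * \<alpha>"
proof -
  have reg: "inner_regular d E" using exp by (simp add: spectral_expander_def)
  have d: "0 < real d" using reg by (simp add: inner_regular_def)
  \<comment> \<open>The outer totals lie in [0, 1] by the substrategy condition, so they can play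
    the role of \<open>F\<close> in the variance bound.\<close>
  define F where "F u = (\<Sum>a'\<in>answer_maps E u. f u a')" for u
  have F: "0 \<le> F u" "F u \<le> 1" for u
    using f by (auto simp: F_def concat_substrategy_def intro: sum_nonneg)
  have t: "total (induced E f) v = (\<Sum>u\<in>nbrs_inner E v. F u) / real d" for v
    by (simp add: total_induced[OF reg] F_def)
  show "(\<Sum>v\<in>UNIV. (total (induced E f) v - \<alpha>)\<^sup>2) / real CARD('v) \<le> K\<^sup>2 * \<alpha>"
    using spectral_expander_variance_le[OF exp K F] by (simp add: t \<alpha>_def)
  have "total (induced E f) v \<in> {0..1}" for v
  proof -
    have "(\<Sum>u\<in>nbrs_inner E v. F u) \<le> (\<Sum>u\<in>nbrs_inner E v. 1)"
      by (intro sum_mono F)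
    then show ?thesis
      using d F by (auto simp: t inner_regular_nbrs[OF reg] intro!: sum_nonneg divide_nonneg_nonneg)
  qed
  then have "0 \<le> (\<Sum>v\<in>UNIV. total (induced E f) v)"
    "(\<Sum>v\<in>UNIV. total (induced E f) v) \<le> (\<Sum>v\<in>(UNIV::'v set). 1)"
    by (auto intro!: sum_nonneg sum_mono simp del: sum_constant)
  then show "\<alpha> \<in> {0..1}"
    by (simp add: \<alpha>_def)
qed

theorem theorem1p2:
  fixes G :: "('x::finite, 'y::finite, 'a::finite, 'b::finite) game"
    and M :: "('u::finite, 'x) bigraph"
    and P :: "('w::finite, 'y) bigraph"
    and dM dP :: nat
    and \<epsilon> \<delta> l :: real
  assumes "\<epsilon> \<in> {0..1}" and "\<delta> \<in> {0..1}"
    and "biregular G"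
    and "spectral_expander dM l M"
    and "spectral_expander dP l P"
    and "l \<le> \<epsilon> / 2 * sqrt (\<delta> / 2)"
  shows "weakly_fortified \<epsilon> \<delta> M G P"
  unfolding weakly_fortified_def
proof (intro allI impI)
  fix f :: "'u \<Rightarrow> ('x \<Rightarrow> 'a) \<Rightarrow> real" and g :: "'w \<Rightarrow> ('y \<Rightarrow> 'b) \<Rightarrow> real"
  assume "concat_substrategy M f \<and> concat_substrategy P g"
  then have f: "concat_substrategy M f" and g: "concat_substrategy P g" by auto
  let ?E = "measure_pmf.expectation (questions G)"
  define K where "K = \<epsilon> / 2 * sqrt (\<delta> / 2)"
  have K: "l \<le> K" "0 \<le> K" using assms by (auto simp: K_def)
  have regs: "inner_regular dM M" "inner_regular dP P"
    using assms by (auto simp: spectral_expander_def)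
  obtain h where h: "complete_strategy h" "\<And>x a. induced M f x a = total (induced M f) x * h x a"
    using complete_strategy_normalize[of "induced M f"] induced_nonneg[OF regs(1) f] by blast
  obtain k where k: "complete_strategy k" "\<And>y b. induced P g y b = total (induced P g) y * k y b"
    using complete_strategy_normalize[of "induced P g"] induced_nonneg[OF regs(2) g] by blast
  define r where "r z = total (induced M f) (fst z)" for z :: "'x \<times> 'y"
  define s where "s z = total (induced P g) (snd z)" for z :: "'x \<times> 'y"
  define W where "W z = (\<Sum>a\<in>UNIV. \<Sum>b\<in>UNIV.
    of_bool (wins G a b (fst z) (snd z)) * h (fst z) a * k (snd z) b)" for z
  have EW: "?E W = strategy_value G h k"
    by (simp add: strategy_value_def W_def[abs_def] case_prod_unfold)
  have W: "W z \<in> {0..1}" for z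
    unfolding W_def
    by (rule sum_of_bool_mult_bounds) (simp_all add: complete_strategyD[OF h(1)] complete_strategyD[OF k(1)])
  have "strategy_value G h k \<in> {0..1}"
    using h k by (intro strategy_value_bounds)
  \<comment> \<open>With \<open>v\<close> taken to be the game value, the estimate needs it in
    [0, 1] so that \<open>W - v\<close> stays within [-1, 1].\<close>
  moreover have "game_value G \<le> 1"
    unfolding game_value_def
    by (rule cSUP_least) (use h k strategy_value_bounds in fastforce)+
  ultimately have v: "strategy_value G h k \<le> game_value G" "game_value G \<in> {0..1}"
    using strategy_value_le_game_value[OF h(1) k(1), of G] by auto
  note est_f = induced_total_estimates[OF assms(4) K f] and est_g = induced_total_estimates[OF assms(5) K g]
  have Er: "?E r = (\<Sum>x\<in>UNIV. total (induced M f) x) / real CARD('x)"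
    and Es: "?E s = (\<Sum>y\<in>UNIV. total (induced P g) y) / real CARD('y)"
    unfolding r_def s_def by (rule expectation_marginals[OF assms(3)])+
  have "?E (\<lambda>z. r z * s z * W z) \<le> (game_value G + \<epsilon>) * ?E (\<lambda>z. r z * s z) + \<delta>"
  proof (rule almost_constant_weights_estimate[where K = K])
    show "?E (\<lambda>z. (r z - ?E r)\<^sup>2) \<le> K\<^sup>2 * ?E r"
      using est_f(2) unfolding Er unfolding r_def
      by (simp only: expectation_marginals(1)[OF assms(3), of "\<lambda>x. (total (induced M f) x - c)\<^sup>2" for c])
    show "?E (\<lambda>z. (s z - ?E s)\<^sup>2) \<le> K\<^sup>2 * ?E s"
      using est_g(2) unfolding Es unfolding s_def
      by (simp only: expectation_marginals(2)[OF assms(3), of "\<lambda>y. (total (induced P g) y - c)\<^sup>2" for c])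
  qed (use est_f(1) est_g(1) Er Es W EW v assms K_def in simp_all)
  moreover have "concat_value M G P f g = ?E (\<lambda>z. r z * s z * W z)"
  proof -
    have "concat_value M G P f g = ?E (\<lambda>(x, y). \<Sum>a\<in>UNIV. \<Sum>b\<in>UNIV.
        of_bool (wins G a b x y) * (total (induced M f) x * h x a) * (total (induced P g) y * k y b))"
      unfolding concat_value_eq_strategy_value_induced[OF regs] strategy_value_def
      by (simp only: h(2)[symmetric] k(2)[symmetric])
    also have "\<dots> = ?E (\<lambda>z. r z * s z * W z)"
      \<comment> \<open>The totals do not depend on the answers, so they leave both sums and the
        winning probability \<open>W\<close> of the normalised strategies remains.\<close>
      by (simp add: r_def s_def W_def case_prod_unfold sum_distrib_left mult_ac)
    finally show ?thesis .
  qed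
  ultimately show "concat_value M G P f g \<le> (game_value G + \<epsilon>) *
      ?E (\<lambda>(x, y). total (induced M f) x * total (induced P g) y) + \<delta>"
    by (simp add: r_def s_def case_prod_unfold)
qed

end
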